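(* Let $R=\bigoplus_{i\in\mathbb{Z}}R_i$ be a $\mathbb{Z}$-graded ring. Then the nil radical of $R$ is a homogeneous ideal of $R$.
   Context: Rings are associative and are not assumed to have an identity element. A $\mathbb{Z}$-graded ring is a ring $R$ with a decomposition $R=\bigoplus_{i\in\mathbb{Z}}R_i$ into additive subgroups with $R_iR_j\subseteq R_{i+j}$ for all $i,j\in\mathbb{Z}$. An element is homogeneous if it lies in some $R_i$. A (two-sided) ideal of a graded ring is homogeneous if it is generated, as an ideal, by homogeneous elements. An ideal is nil if each of its elements is nilpotent. The nil radical of $R$ is the largest nil two-sided ideal of $R$ (equivalently, the sum of all nil two-sided ideals of $R$, which is itself nil). *)

theory Defs
  imports Main "HOL.Hull"
begin

text \<open>
  The class \<^class>\<open>ring\<close> does not assume an identity element; the ring \<open>R\<close> is the whole type.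
\<close>

definition additive_subgroup :: "'a::ring set \<Rightarrow> bool" where
  "additive_subgroup A \<longleftrightarrow> 0 \<in> A \<and> (\<forall>x\<in>A. \<forall>y\<in>A. x + y \<in> A) \<and> (\<forall>x\<in>A. - x \<in> A)"

definition two_sided_ideal :: "'a::ring set \<Rightarrow> bool" where
  "two_sided_ideal I \<longleftrightarrow> additive_subgroup I \<and> (\<forall>r. \<forall>x\<in>I. r * x \<in> I \<and> x * r \<in> I)"

text \<open>
  Without an identity there is no zeroth power: \<open>((*) x ^^ n) x\<close> is the power of \<open>x\<close> with
  exponent \<open>n + 1\<close>.
\<close>

definition nilpotent :: "'a::ring \<Rightarrow> bool" where
  "nilpotent x \<longleftrightarrow> (\<exists>n. ((*) x ^^ n) x = 0)"

definition nil_ideal :: "'a::ring set \<Rightarrow> bool" where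
  "nil_ideal I \<longleftrightarrow> two_sided_ideal I \<and> (\<forall>x\<in>I. nilpotent x)"

text \<open>
  The largest nil ideal with respect to inclusion; it exists by \<open>nil_ideal_nil_radical\<close> and
  \<open>nil_ideal_subset_nil_radical\<close> below, and it is the sum of all nil ideals by
  \<open>nil_radical_eq_sum\<close>.
\<close>

definition nil_radical :: "'a::ring set" where
  "nil_radical = (GREATEST I. nil_ideal I)"

text \<open>
  The third condition is the direct sum decomposition: every element is the sum of a unique
  finitely supported family of components \<open>c i \<in> R i\<close>.
\<close>

definition int_graded :: "(int \<Rightarrow> 'a::ring set) \<Rightarrow> bool" where
  "int_graded R \<longleftrightarrow>
     (\<forall>i. additive_subgroup (R i)) \<and>
     (\<forall>i j. \<forall>x\<in>R i. \<forall>y\<in>R j. x * y \<in> R (i + j)) \<and>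
     (\<forall>x. \<exists>!c. (\<forall>i. c i \<in> R i) \<and> finite {i. c i \<noteq> 0} \<and> x = (\<Sum>i | c i \<noteq> 0. c i))"

definition homogeneous :: "(int \<Rightarrow> 'a::ring set) \<Rightarrow> 'a \<Rightarrow> bool" where
  "homogeneous R x \<longleftrightarrow> (\<exists>i. x \<in> R i)"

text \<open>\<open>two_sided_ideal hull S\<close> is the two-sided ideal generated by \<open>S\<close>.\<close>

definition homogeneous_ideal :: "(int \<Rightarrow> 'a::ring set) \<Rightarrow> 'a set \<Rightarrow> bool" where
  "homogeneous_ideal R I \<longleftrightarrow>
     two_sided_ideal I \<and> (\<exists>S. (\<forall>x\<in>S. homogeneous R x) \<and> I = two_sided_ideal hull S)"

lemma two_sided_ideal_hull: "two_sided_ideal (two_sided_ideal hull S)"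
  by (rule hull_in) (simp add: two_sided_ideal_def additive_subgroup_def)

lemma power_add_diff_mem:
  assumes "two_sided_ideal J" "b \<in> J"
  shows "((*) (a + b) ^^ n) (a + b) - ((*) a ^^ n) a \<in> J"
proof (induction n)
  case 0
  then show ?case using assms by simp
next
  case (Suc n)
  let ?p = "((*) (a + b) ^^ n) (a + b)" and ?q = "((*) a ^^ n) a"
  have "((*) (a + b) ^^ Suc n) (a + b) - ((*) a ^^ Suc n) a = a * (?p - ?q) + b * ?p"
    by (simp add: algebra_simps)
  also have "\<dots> \<in> J"
    using Suc assms unfolding two_sided_ideal_def additive_subgroup_def by blast
  finally show ?case .
qed

lemma power_mult_power:
  fixes x :: "'a::ring"
  shows "((*) x ^^ m) x * ((*) x ^^ n) x = ((*) x ^^ (Suc (m + n))) x"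
  by (induction m) (simp_all add: mult.assoc)

lemma power_of_power:
  fixes x :: "'a::ring"
  shows "\<exists>k. ((*) (((*) x ^^ n) x) ^^ m) (((*) x ^^ n) x) = ((*) x ^^ k) x"
proof (induction m)
  case 0
  then show ?case by auto
next
  case (Suc m)
  then obtain k where k: "((*) (((*) x ^^ n) x) ^^ m) (((*) x ^^ n) x) = ((*) x ^^ k) x" by blast
  have "((*) (((*) x ^^ n) x) ^^ Suc m) (((*) x ^^ n) x) = ((*) x ^^ (Suc (n + k))) x"
    using power_mult_power[of n x k] by (simp add: k)
  then show ?case by blast
qed

lemma nilpotent_of_power: "nilpotent (((*) x ^^ n) x) \<Longrightarrow> nilpotent x"
  unfolding nilpotent_def using power_of_power[of _ n x] by metis

lemma nil_idealI:
  assumes "0 \<in> I" "\<And>x y. x \<in> I \<Longrightarrow> y \<in> I \<Longrightarrow> x + y \<in> I" "\<And>x. x \<in> I \<Longrightarrow> - x \<in> I"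
    "\<And>r x. x \<in> I \<Longrightarrow> r * x \<in> I" "\<And>r x. x \<in> I \<Longrightarrow> x * r \<in> I"
    "\<And>x. x \<in> I \<Longrightarrow> nilpotent x"
  shows "nil_ideal I"
  using assms unfolding nil_ideal_def two_sided_ideal_def additive_subgroup_def by simp

lemma nil_ideal_plus:
  assumes "nil_ideal I" "nil_ideal J"
  shows "nil_ideal {a + b | a b. a \<in> I \<and> b \<in> J}"
proof -
  let ?K = "{a + b | a b. a \<in> I \<and> b \<in> J}"
  have I: "0 \<in> I" "\<And>x y. x \<in> I \<Longrightarrow> y \<in> I \<Longrightarrow> x + y \<in> I" "\<And>x. x \<in> I \<Longrightarrow> - x \<in> I"
      "\<And>r x. x \<in> I \<Longrightarrow> r * x \<in> I" "\<And>r x. x \<in> I \<Longrightarrow> x * r \<in> I"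
   and J: "0 \<in> J" "\<And>x y. x \<in> J \<Longrightarrow> y \<in> J \<Longrightarrow> x + y \<in> J" "\<And>x. x \<in> J \<Longrightarrow> - x \<in> J"
      "\<And>r x. x \<in> J \<Longrightarrow> r * x \<in> J" "\<And>r x. x \<in> J \<Longrightarrow> x * r \<in> J"
    using assms unfolding nil_ideal_def two_sided_ideal_def additive_subgroup_def by auto
  show ?thesis
  proof (rule nil_idealI)
    show "0 \<in> ?K" using I(1) J(1) by force
  next
    fix x y assume "x \<in> ?K" "y \<in> ?K"
    then obtain a b c d where *: "x = a + b" "a \<in> I" "b \<in> J" "y = c + d" "c \<in> I" "d \<in> J"
      by blast
    then have "x + y = (a + c) + (b + d)" by (simp add: algebra_simps)
    with * I(2) J(2) show "x + y \<in> ?K" by blast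
  next
    fix x assume "x \<in> ?K"
    then obtain a b where *: "x = a + b" "a \<in> I" "b \<in> J" by blast
    then have "- x = - a + - b" by simp
    with * I(3) J(3) show "- x \<in> ?K" by blast
  next
    fix r x assume "x \<in> ?K"
    then obtain a b where *: "x = a + b" "a \<in> I" "b \<in> J" by blast
    then have "r * x = r * a + r * b" "x * r = a * r + b * r"
      by (simp_all add: distrib_left distrib_right)
    with * I(4,5) J(4,5) show "r * x \<in> ?K" "x * r \<in> ?K" by blast+
  next
    fix x assume "x \<in> ?K"
    then obtain a b where ab: "x = a + b" "a \<in> I" "b \<in> J" by blast
    then obtain n where "((*) a ^^ n) a = 0"
      using assms unfolding nil_ideal_def nilpotent_def by blast
    moreover have "((*) (a + b) ^^ n) (a + b) - ((*) a ^^ n) a \<in> J"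
      using assms(2) ab(3) by (intro power_add_diff_mem) (simp_all add: nil_ideal_def)
    ultimately have "((*) x ^^ n) x \<in> J" by (simp add: ab(1))
    then have "nilpotent (((*) x ^^ n) x)"
      using assms(2) unfolding nil_ideal_def by blast
    then show "nilpotent x" by (rule nilpotent_of_power)
  qed
qed

lemma nil_ideal_Union: "nil_ideal (\<Union>{I :: 'a::ring set. nil_ideal I})" (is "nil_ideal ?N")
proof -
  have "nil_ideal {0 :: 'a}"
    unfolding nil_ideal_def two_sided_ideal_def additive_subgroup_def nilpotent_def
    by (auto intro: exI[of _ 0])
  then have zero: "0 \<in> ?N" by blast
  have *: "- x \<in> ?N" "r * x \<in> ?N" "x * r \<in> ?N" "nilpotent x" if x: "x \<in> ?N" for r x
  proof -
    from x obtain I where I: "nil_ideal I" "x \<in> I" by blast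
    then have "- x \<in> I" "r * x \<in> I" "x * r \<in> I" "nilpotent x"
      unfolding nil_ideal_def two_sided_ideal_def additive_subgroup_def by simp_all
    with I(1) show "- x \<in> ?N" "r * x \<in> ?N" "x * r \<in> ?N" "nilpotent x" by blast+
  qed
  show ?thesis
  proof (rule nil_idealI)
    fix x y assume "x \<in> ?N" "y \<in> ?N"
    then obtain I J where "nil_ideal I" "x \<in> I" "nil_ideal J" "y \<in> J" by blast
    then show "x + y \<in> ?N" using nil_ideal_plus[of I J] by blast
  qed (use zero * in blast)+
qed

lemma nil_radical_eq_Union: "nil_radical = \<Union>{I. nil_ideal I}"
  unfolding nil_radical_def
  by (rule Greatest_equality) (use nil_ideal_Union in auto)

lemma nil_ideal_nil_radical: "nil_ideal nil_radical"
  unfolding nil_radical_eq_Union by (rule nil_ideal_Union)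

lemma nil_ideal_subset_nil_radical: "nil_ideal I \<Longrightarrow> I \<subseteq> nil_radical"
  unfolding nil_radical_eq_Union by blast

lemma nil_radical_eq_sum:
  "(nil_radical :: 'a::ring set) = two_sided_ideal hull (\<Union>{I. nil_ideal I})"
proof -
  have "two_sided_ideal (nil_radical :: 'a::ring set)"
    using nil_ideal_nil_radical by (auto simp only: nil_ideal_def)
  from hull_same[of two_sided_ideal, OF this] show ?thesis
    unfolding nil_radical_eq_Union by (rule sym)
qed

end

theory Submission
  imports Defs
begin

text \<open>
  Write \<open>N\<close> for the nil radical and call the ideal of all elements whose homogeneous components
  lie in \<open>N\<close> its core. The claim is that \<open>N\<close> equals its core. Let \<open>a \<in> N\<close> have components
  \<open>a\<^sub>i\<close>; by induction on the number of nonzero components, every element of \<open>N\<close> with fewer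
  nonzero components than \<open>a\<close> may be assumed to lie in the core.

  Apply one and the same combination of sums, negatives and multiplications by ring elements to all
  the \<open>a\<^sub>i\<close>. This gives a family \<open>z = (z\<^sub>i)\<close> whose sum \<open>Z\<close> lies in the ideal generated by \<open>a\<close>,
  hence in \<open>N\<close>, whereas for a fixed \<open>i\<close> the entries \<open>z\<^sub>i\<close> run through the ideal generated by
  \<open>a\<^sub>i\<close>. Two observations carry the proof.

  \<^item> Rigidity (\<open>simultaneous_multiples_rigid\<close>): if \<open>z\<close> is homogeneous, \<open>z\<^sub>i\<close> having degree
    \<open>e + i\<close>, and one \<open>z\<^sub>j\<close> with \<open>a\<^sub>j \<noteq> 0\<close> lies in \<open>N\<close>, then all \<open>z\<^sub>i\<close> do. For
    \<open>Z - z\<^sub>j\<close> is an element of \<open>N\<close> with fewer components than \<open>a\<close>, so the induction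
    hypothesis applies to it.
  \<^item> Cancellation (\<open>simultaneous_multiples_cancel\<close>): if \<open>Z\<close> lies in the core, then so does every
    \<open>z\<^sub>i\<close>. Modulo the core, one may picture \<open>z\<^sub>i\<close> as \<open>\<lambda>\<^sub>i z\<^sub>m\<close>, with \<open>m\<close> the
    lowest degree of \<open>a\<close> and central \<open>\<lambda>\<^sub>i\<close> of pairwise distinct degrees; looking at lowest degrees shows that \<open>\<Sum>\<lambda>\<^sub>i\<close> is not a zero divisor.

  Now \<open>Z \<in> N\<close> is nilpotent. As \<open>(p z\<^sub>i q)\<close> is again a family of the above kind, cancellation
  replaces the factors of a vanishing product \<open>p Z \<dots> Z\<close> by \<open>z\<^sub>i\<close> one after the other, so some
  power of \<open>z\<^sub>i\<close> lies in the core, and \<open>z\<^sub>i\<close> is nilpotent. Hence each \<open>a\<^sub>i\<close> generates a nil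
  ideal, that is, \<open>a\<^sub>i \<in> N\<close>.
\<close>

section \<open>Two-sided ideals\<close>

lemma two_sided_ideal_closed:
  assumes "two_sided_ideal I"
  shows "0 \<in> I" "x \<in> I \<Longrightarrow> y \<in> I \<Longrightarrow> x + y \<in> I" "x \<in> I \<Longrightarrow> - x \<in> I"
    "x \<in> I \<Longrightarrow> r * x \<in> I" "x \<in> I \<Longrightarrow> x * r \<in> I"
  using assms unfolding two_sided_ideal_def additive_subgroup_def by auto

lemma two_sided_ideal_diff:
  assumes "two_sided_ideal I" "x \<in> I" "y \<in> I"
  shows "x - y \<in> I"
  using two_sided_ideal_closed(2)[OF assms(1,2) two_sided_ideal_closed(3)[OF assms(1,3)]] by simp

lemma two_sided_ideal_sum:
  assumes "two_sided_ideal I" "\<And>i. i \<in> A \<Longrightarrow> f i \<in> I"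
  shows "sum f A \<in> I"
  using assms(2)
  by (induction A rule: infinite_finite_induct) (auto intro: two_sided_ideal_closed[OF assms(1)])

section \<open>Simultaneous multiples of a family\<close>

text \<open>
  The bimodule generated by the family \<open>c\<close> inside the bimodule of all families. Working with it
  instead of the ideals generated by the single \<open>c i\<close> ties the entries at different indices
  together although the correspondence between these ideals need not be a well-defined map.
\<close>

inductive_set simultaneous_multiples :: "('i \<Rightarrow> 'a::ring) \<Rightarrow> ('i \<Rightarrow> 'a) set"
  for c :: "'i \<Rightarrow> 'a" where
  base: "c \<in> simultaneous_multiples c"
| add: "y \<in> simultaneous_multiples c \<Longrightarrow> z \<in> simultaneous_multiples c \<Longrightarrow>
    (\<lambda>i. y i + z i) \<in> simultaneous_multiples c"
| minus: "z \<in> simultaneous_multiples c \<Longrightarrow> (\<lambda>i. - z i) \<in> simultaneous_multiples c"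
| left: "z \<in> simultaneous_multiples c \<Longrightarrow> (\<lambda>i. r * z i) \<in> simultaneous_multiples c"
| right: "z \<in> simultaneous_multiples c \<Longrightarrow> (\<lambda>i. z i * r) \<in> simultaneous_multiples c"

lemma simultaneous_multiples_zero: "(\<lambda>i. 0) \<in> simultaneous_multiples c"
  using simultaneous_multiples.add[OF simultaneous_multiples.base
      simultaneous_multiples.minus[OF simultaneous_multiples.base], of c] by simp

lemma simultaneous_multiples_sum:
  assumes "\<And>d. d \<in> A \<Longrightarrow> f d \<in> simultaneous_multiples c"
  shows "(\<lambda>i. \<Sum>d\<in>A. f d i) \<in> simultaneous_multiples c"
  using assms
  by (induction A rule: infinite_finite_induct)
    (auto intro: simultaneous_multiples_zero simultaneous_multiples.add)

lemma simultaneous_multiples_eq_0: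
  assumes "z \<in> simultaneous_multiples c" "c i = 0"
  shows "z i = 0"
  using assms by induction auto

lemma sum_simultaneous_multiples_mem:
  assumes "two_sided_ideal I" "sum c A \<in> I" "z \<in> simultaneous_multiples c"
  shows "sum z A \<in> I"
  using assms(3)
proof induction
  case base
  then show ?case by (rule assms(2))
qed (auto simp: sum.distrib sum_negf sum_distrib_left[symmetric] sum_distrib_right[symmetric]
    intro: two_sided_ideal_closed[OF assms(1)])

lemma two_sided_ideal_entries:
  "two_sided_ideal ((\<lambda>z. z i) ` simultaneous_multiples c)"
proof -
  define J where "J = (\<lambda>z. z i) ` simultaneous_multiples c"
  have entry: "z i \<in> J" if "z \<in> simultaneous_multiples c" for z
    unfolding J_def using that by (rule imageI)
  have zero: "0 \<in> J"
    using entry[OF simultaneous_multiples_zero] .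
  have add: "x + y \<in> J" if "x \<in> J" "y \<in> J" for x y
  proof -
    obtain u v where uv: "u \<in> simultaneous_multiples c" "v \<in> simultaneous_multiples c"
      "x = u i" "y = v i" using \<open>x \<in> J\<close> \<open>y \<in> J\<close> unfolding J_def by blast
    show ?thesis
      using entry[OF simultaneous_multiples.add[OF uv(1,2)]] by (simp add: uv(3,4))
  qed
  have closed: "- x \<in> J" "r * x \<in> J" "x * r \<in> J" if "x \<in> J" for x r
  proof -
    obtain u where u: "u \<in> simultaneous_multiples c" "x = u i"
      using \<open>x \<in> J\<close> unfolding J_def by blast
    show "- x \<in> J" "r * x \<in> J" "x * r \<in> J"
      using entry[OF simultaneous_multiples.minus[OF u(1)]]
        entry[OF simultaneous_multiples.left[OF u(1)]]
        entry[OF simultaneous_multiples.right[OF u(1)]]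
      by (simp_all add: u(2))
  qed
  have "two_sided_ideal J"
    unfolding two_sided_ideal_def additive_subgroup_def
    by (intro conjI ballI allI zero add closed)
  then show ?thesis by (simp only: J_def)
qed

section \<open>Homogeneous components\<close>

locale int_graded_ring =
  fixes R :: "int \<Rightarrow> 'a::ring set"
  assumes graded: "int_graded R"
begin

definition component :: "'a \<Rightarrow> int \<Rightarrow> 'a" where
  "component x =
     (THE c. (\<forall>i. c i \<in> R i) \<and> finite {i. c i \<noteq> 0} \<and> x = (\<Sum>i | c i \<noteq> 0. c i))"

abbreviation degrees :: "'a \<Rightarrow> int set" where
  "degrees x \<equiv> {i. component x i \<noteq> 0}"

lemma grade_closed:
  "0 \<in> R i" "x \<in> R i \<Longrightarrow> y \<in> R i \<Longrightarrow> x + y \<in> R i" "x \<in> R i \<Longrightarrow> y \<in> R j \<Longrightarrow> x * y \<in> R (i + j)"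
  using graded unfolding int_graded_def additive_subgroup_def by auto

lemma decomposition_unique:
  "\<exists>!c. (\<forall>i. c i \<in> R i) \<and> finite {i. c i \<noteq> 0} \<and> x = (\<Sum>i | c i \<noteq> 0. c i)"
  using graded unfolding int_graded_def by blast

lemma component_mem: "component x i \<in> R i"
  and finite_degrees: "finite (degrees x)"
  and sum_component: "(\<Sum>i\<in>degrees x. component x i) = x"
  using theI'[OF decomposition_unique[of x]] unfolding component_def[symmetric] by auto

lemma component_eqI:
  assumes c: "\<And>i. c i \<in> R i" and A: "finite A" "\<And>i. i \<notin> A \<Longrightarrow> c i = 0" and x: "x = sum c A"
  shows "component x = c"
proof -
  have fin: "finite {i. c i \<noteq> 0}"
    using A by (auto intro: finite_subset[of _ A])
  have "x = (\<Sum>i | c i \<noteq> 0. c i)"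
    unfolding x using A by (intro sum.mono_neutral_right) auto
  with c fin show ?thesis
    unfolding component_def by (intro the1_equality[OF decomposition_unique]) auto
qed

lemma sum_component_superset:
  assumes "finite A" "degrees x \<subseteq> A"
  shows "sum (component x) A = x"
proof -
  have "sum (component x) A = sum (component x) (degrees x)"
    using assms by (intro sum.mono_neutral_right) auto
  then show ?thesis by (simp add: sum_component)
qed

lemma component_add: "component (x + y) = (\<lambda>i. component x i + component y i)"
proof (rule component_eqI[where A = "degrees x \<union> degrees y"])
  show "x + y = (\<Sum>i\<in>degrees x \<union> degrees y. component x i + component y i)"
    by (simp add: sum.distrib sum_component_superset finite_degrees)
qed (auto simp: finite_degrees intro: grade_closed component_mem)

lemma component_homogeneous:
  assumes "x \<in> R d"
  shows "component x = (\<lambda>i. if i = d then x else 0)"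
  by (rule component_eqI[where A = "{d}"]) (use assms grade_closed(1) in auto)

lemma component_zero: "component 0 = (\<lambda>i. 0)"
  using component_homogeneous[OF grade_closed(1)] by (simp cong: if_cong)

lemma component_minus: "component (- x) i = - component x i"
  using component_add[of x "- x", THEN fun_cong, of i]
  by (simp add: component_zero eq_neg_iff_add_eq_0 add.commute)

lemma component_sum: "component (sum f A) n = (\<Sum>i\<in>A. component (f i) n)"
  by (induction A rule: infinite_finite_induct) (auto simp: component_zero component_add)

lemma component_mult_homogeneous_left:
  assumes "r \<in> R d"
  shows "component (r * x) = (\<lambda>n. r * component x (n - d))"
proof (rule component_eqI[where A = "(+) d ` degrees x"])
  show "r * component x (n - d) \<in> R n" for n
    using grade_closed(3)[OF assms component_mem, of x "n - d"] by simp
  show "r * component x (n - d) = 0" if "n \<notin> (+) d ` degrees x" for n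
  proof -
    have "n - d \<notin> degrees x"
      using that image_eqI[of n "(+) d" "n - d" "degrees x"] by auto
    then show ?thesis by simp
  qed
  show "r * x = (\<Sum>n\<in>(+) d ` degrees x. r * component x (n - d))"
    by (simp add: sum.reindex sum_distrib_left[symmetric] sum_component)
qed (simp add: finite_degrees)

lemma component_mult_homogeneous_right:
  assumes "r \<in> R d"
  shows "component (x * r) = (\<lambda>n. component x (n - d) * r)"
proof (rule component_eqI[where A = "(+) d ` degrees x"])
  show "component x (n - d) * r \<in> R n" for n
    using grade_closed(3)[OF component_mem assms, of x "n - d"] by simp
  show "component x (n - d) * r = 0" if "n \<notin> (+) d ` degrees x" for n
  proof -
    have "n - d \<notin> degrees x"
      using that image_eqI[of n "(+) d" "n - d" "degrees x"] by auto
    then show ?thesis by simp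
  qed
  show "x * r = (\<Sum>n\<in>(+) d ` degrees x. component x (n - d) * r)"
    by (simp add: sum.reindex sum_distrib_right[symmetric] sum_component)
qed (simp add: finite_degrees)

lemma component_mult_left:
  "component (r * x) n = (\<Sum>d\<in>degrees r. component r d * component x (n - d))"
proof -
  have "component (r * x) n = component (\<Sum>d\<in>degrees r. component r d * x) n"
    by (simp add: sum_distrib_right[symmetric] sum_component)
  then show ?thesis
    by (simp add: component_sum component_mult_homogeneous_left[OF component_mem])
qed

lemma component_mult_right:
  "component (x * r) n = (\<Sum>d\<in>degrees r. component x (n - d) * component r d)"
proof -
  have "component (x * r) n = component (\<Sum>d\<in>degrees r. x * component r d) n"
    by (simp add: sum_distrib_left[symmetric] sum_component)
  then show ?thesis
    by (simp add: component_sum component_mult_homogeneous_right[OF component_mem])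
qed

text \<open>
  As \<open>component a i\<close> has degree \<open>i\<close>, the natural grading on families puts the homogeneous
  part of degree \<open>e\<close> of the entry at \<open>i\<close> into degree \<open>e + i\<close>.
\<close>

lemma simultaneous_multiples_part:
  assumes "z \<in> simultaneous_multiples (component a)"
  shows "(\<lambda>i. component (z i) (e + i)) \<in> simultaneous_multiples (component a)"
  using assms
proof (induction arbitrary: e)
  case base
  have "(\<lambda>i. component (component a i) (e + i)) = (if e = 0 then component a else (\<lambda>i. 0))"
    by (auto simp: component_homogeneous[OF component_mem])
  then show ?case
    by (simp add: simultaneous_multiples_zero simultaneous_multiples.base)
next
  case (add y z)
  then show ?case by (simp add: component_add simultaneous_multiples.add)
next
  case (minus z)
  then show ?case by (simp add: component_minus simultaneous_multiples.minus)
next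
  case (left z r)
  have "(\<lambda>i. component (z i) (e + i - d)) \<in> simultaneous_multiples (component a)" for d
    using left.IH[of "e - d"] by (simp add: algebra_simps)
  then show ?case
    unfolding component_mult_left
    by (intro simultaneous_multiples_sum simultaneous_multiples.left)
next
  case (right z r)
  have "(\<lambda>i. component (z i) (e + i - d)) \<in> simultaneous_multiples (component a)" for d
    using right.IH[of "e - d"] by (simp add: algebra_simps)
  then show ?case
    unfolding component_mult_right
    by (intro simultaneous_multiples_sum simultaneous_multiples.right)
qed

section \<open>The homogeneous core of an ideal\<close>

definition homogeneous_core :: "'a set \<Rightarrow> 'a set" where
  "homogeneous_core I = {x. \<forall>i. component x i \<in> I}"

lemma homogeneous_core_subset:
  assumes "two_sided_ideal I"
  shows "homogeneous_core I \<subseteq> I"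
proof
  fix x assume "x \<in> homogeneous_core I"
  then have "(\<Sum>i\<in>degrees x. component x i) \<in> I"
    unfolding homogeneous_core_def by (intro two_sided_ideal_sum[OF assms]) auto
  then show "x \<in> I" by (simp add: sum_component)
qed

text \<open>
  An ideal contained in its core is generated by its homogeneous elements, since these include
  all components of its elements.
\<close>

lemma homogeneous_idealI:
  assumes I: "two_sided_ideal I" and core: "I \<subseteq> homogeneous_core I"
  shows "homogeneous_ideal R I"
proof -
  let ?S = "{x \<in> I. homogeneous R x}"
  have "two_sided_ideal hull ?S \<subseteq> I"
    by (rule hull_minimal) (use I in auto)
  moreover have "I \<subseteq> two_sided_ideal hull ?S"
  proof
    fix x assume "x \<in> I"
    then have "component x i \<in> ?S" for i
      using core component_mem unfolding homogeneous_core_def homogeneous_def by blast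
    then have "component x i \<in> two_sided_ideal hull ?S" for i
      using hull_subset[of ?S two_sided_ideal] by blast
    then have "(\<Sum>i\<in>degrees x. component x i) \<in> two_sided_ideal hull ?S"
      by (intro two_sided_ideal_sum[OF two_sided_ideal_hull]) auto
    then show "x \<in> two_sided_ideal hull ?S" by (simp add: sum_component)
  qed
  ultimately show ?thesis
    unfolding homogeneous_ideal_def using I by (intro conjI exI[of _ ?S]) auto
qed

section \<open>Rigidity and cancellation\<close>

text \<open>
  Removing the entry at \<open>j\<close> from the sum of the family leaves an element of \<open>I\<close> with fewer
  components than \<open>a\<close>; the hypothesis \<open>smaller\<close>, the form in which the induction on the number
  of components enters, then puts all its components into \<open>I\<close>.
\<close>

lemma simultaneous_multiples_rigid:
  assumes I: "two_sided_ideal I" and a: "a \<in> I"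
    and smaller: "\<forall>b\<in>I. card (degrees b) < card (degrees a) \<longrightarrow> b \<in> homogeneous_core I"
    and y: "y \<in> simultaneous_multiples (component a)" and homog: "\<And>i. y i \<in> R (e + i)"
    and j: "j \<in> degrees a" "y j \<in> I"
  shows "y i \<in> I"
proof -
  let ?A = "degrees a - {j}"
  define b where "b = sum y ?A"
  have "sum y (degrees a) \<in> I"
    using a by (intro sum_simultaneous_multiples_mem[OF I _ y]) (simp add: sum_component)
  moreover have "b = sum y (degrees a) - y j"
    unfolding b_def using j(1) by (simp add: sum_diff1 finite_degrees)
  ultimately have bI: "b \<in> I"
    using j(2) by (simp add: two_sided_ideal_diff[OF I])
  have comp: "component b n = (if n - e \<in> ?A then y (n - e) else 0)" for n
  proof -
    have "component b n = (\<Sum>i\<in>?A. if i = n - e then y i else 0)"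
      unfolding b_def component_sum
      by (intro sum.cong) (auto simp: component_homogeneous[OF homog])
    then show ?thesis by (simp only: sum.delta' sum.delta finite_degrees finite_Diff)
  qed
  have "degrees b \<subseteq> (+) e ` ?A"
  proof
    fix n assume "n \<in> degrees b"
    then have "n - e \<in> ?A" by (auto simp only: comp mem_Collect_eq split: if_splits)
    then show "n \<in> (+) e ` ?A" by (intro image_eqI[of _ _ "n - e"]) auto
  qed
  then have "card (degrees b) \<le> card ?A"
    by (intro surj_card_le) (simp_all only: finite_Diff finite_degrees)
  also have "\<dots> < card (degrees a)"
    using j(1) by (intro card_Diff1_less finite_degrees)
  finally have "b \<in> homogeneous_core I" using smaller bI by blast
  then have *: "component b (e + i) \<in> I" by (simp add: homogeneous_core_def)
  show ?thesis
  proof (cases "i \<in> ?A")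
    case True
    then show ?thesis using * comp[of "e + i"] by simp
  next
    case False
    then have "i = j \<or> y i = 0" using simultaneous_multiples_eq_0[OF y] by auto
    then show ?thesis using j(2) two_sided_ideal_closed(1)[OF I] by auto
  qed
qed

text \<open>
  Let \<open>e\<close> be the lowest degree in which the family \<open>y\<close> has a part outside \<open>I\<close>, and \<open>m\<close>
  the lowest degree of \<open>a\<close>. Modulo \<open>I\<close>, only the entry at \<open>m\<close> contributes to the component
  of the sum of \<open>y\<close> in degree \<open>e + m\<close>, so the part of degree \<open>e\<close> of that entry lies in \<open>I\<close>;
  by rigidity the whole part of degree \<open>e\<close> does.
\<close>

lemma simultaneous_multiples_cancel:
  assumes I: "two_sided_ideal I" and a: "a \<in> I"
    and smaller: "\<forall>b\<in>I. card (degrees b) < card (degrees a) \<longrightarrow> b \<in> homogeneous_core I"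
    and y: "y \<in> simultaneous_multiples (component a)"
    and sum: "sum y (degrees a) \<in> homogeneous_core I"
  shows "y i \<in> homogeneous_core I"
proof -
  define E where "E = {e. \<exists>i. component (y i) (e + i) \<notin> I}"
  have E_index: "i \<in> degrees a" if "component (y i) n \<notin> I" for i n
  proof (rule ccontr)
    assume "i \<notin> degrees a"
    then have "y i = 0" using simultaneous_multiples_eq_0[OF y] by simp
    then show False using that two_sided_ideal_closed(1)[OF I] by (simp add: component_zero)
  qed
  have "E \<subseteq> (\<Union>i\<in>degrees a. (\<lambda>n. n - i) ` degrees (y i))"
  proof
    fix e assume "e \<in> E"
    then obtain i where i: "component (y i) (e + i) \<notin> I" unfolding E_def by blast
    then have "e + i \<in> degrees (y i)" using two_sided_ideal_closed(1)[OF I] by auto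
    then have "e \<in> (\<lambda>n. n - i) ` degrees (y i)" by (intro image_eqI[of _ _ "e + i"]) auto
    then show "e \<in> (\<Union>i\<in>degrees a. (\<lambda>n. n - i) ` degrees (y i))"
      using E_index[OF i] by blast
  qed
  then have finE: "finite E"
    by (rule finite_subset) (intro finite_UN_I finite_imageI finite_degrees)
  have "E = {}"
  proof (rule ccontr)
    assume ne: "E \<noteq> {}"
    define e where "e = Min E"
    define m where "m = Min (degrees a)"
    have eE: "e \<in> E" and e_le: "\<And>e'. e' \<in> E \<Longrightarrow> e \<le> e'"
      unfolding e_def using finE ne by auto
    obtain k where k: "component (y k) (e + k) \<notin> I" using eE unfolding E_def by blast
    from E_index[OF k] have m: "m \<in> degrees a"
      unfolding m_def by (intro Min_in finite_degrees) auto
    have m_le: "m \<le> i" if "i \<in> degrees a" for i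
      unfolding m_def using that by (intro Min_le finite_degrees)
    have "component (y i) (e + m) \<in> I" if "i \<in> degrees a - {m}" for i
    proof (rule ccontr)
      assume "component (y i) (e + m) \<notin> I"
      then have "e + m - i \<in> E" unfolding E_def by (auto intro!: exI[of _ i])
      then show False using e_le[of "e + m - i"] m_le[of i] that by auto
    qed
    then have rest: "(\<Sum>i\<in>degrees a - {m}. component (y i) (e + m)) \<in> I"
      by (intro two_sided_ideal_sum[OF I])
    have "(\<Sum>i\<in>degrees a. component (y i) (e + m)) \<in> I"
      using sum unfolding homogeneous_core_def by (simp add: component_sum)
    moreover have "(\<Sum>i\<in>degrees a. component (y i) (e + m)) =
        component (y m) (e + m) + (\<Sum>i\<in>degrees a - {m}. component (y i) (e + m))"
      using m by (intro sum.remove finite_degrees)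
    ultimately have "component (y m) (e + m) \<in> I"
      using two_sided_ideal_diff[OF I _ rest] by (metis add_diff_cancel_right')
    then have "component (y k) (e + k) \<in> I"
      by (rule simultaneous_multiples_rigid[OF I a smaller simultaneous_multiples_part[OF y]
            component_mem m])
    with k show False by contradiction
  qed
  then have "component (y i) (n - i + i) \<in> I" for n unfolding E_def by blast
  then show ?thesis by (simp add: homogeneous_core_def)
qed

text \<open>
  Each factor of the power of the sum is cancelled in turn. The left factor \<open>p\<close> collects the
  copies of \<open>z i\<close> already obtained; no identity element is available as its initial value,
  which costs one more power of \<open>z i\<close> in the application.
\<close>

lemma simultaneous_multiples_cancel_power:
  assumes I: "two_sided_ideal I" and a: "a \<in> I"
    and smaller: "\<forall>b\<in>I. card (degrees b) < card (degrees a) \<longrightarrow> b \<in> homogeneous_core I"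
    and z: "z \<in> simultaneous_multiples (component a)"
    and Z: "Z = sum z (degrees a)"
    and "p * ((*) Z ^^ n) Z \<in> homogeneous_core I"
  shows "p * ((*) (z i) ^^ n) (z i) \<in> homogeneous_core I"
  using assms(6)
proof (induction n arbitrary: p)
  case 0
  then have "sum (\<lambda>k. p * z k) (degrees a) \<in> homogeneous_core I"
    by (simp add: Z sum_distrib_left)
  from simultaneous_multiples_cancel[OF I a smaller simultaneous_multiples.left[OF z] this]
  show ?case by simp
next
  case (Suc n)
  let ?q = "((*) Z ^^ n) Z"
  have "sum (\<lambda>k. p * z k * ?q) (degrees a) = p * Z * ?q"
    by (simp only: Z sum_distrib_left sum_distrib_right)
  with Suc.prems have "sum (\<lambda>k. p * z k * ?q) (degrees a) \<in> homogeneous_core I"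
    by (simp add: mult.assoc)
  from simultaneous_multiples_cancel[OF I a smaller
      simultaneous_multiples.right[OF simultaneous_multiples.left[OF z]] this]
  have "p * z i * ?q \<in> homogeneous_core I" .
  from Suc.IH[OF this] show ?case by (simp add: mult.assoc)
qed

section \<open>Homogeneity of the nil radical\<close>

lemma nil_radical_subset_homogeneous_core: "nil_radical \<subseteq> homogeneous_core nil_radical"
proof
  let ?N = "nil_radical :: 'a set"
  have N: "two_sided_ideal ?N" and nil: "\<And>x. x \<in> ?N \<Longrightarrow> nilpotent x"
    using nil_ideal_nil_radical unfolding nil_ideal_def by blast+
  fix a assume "a \<in> ?N"
  then show "a \<in> homogeneous_core ?N"
  proof (induction "card (degrees a)" arbitrary: a rule: less_induct)
    case less
    note a = \<open>a \<in> ?N\<close>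
    have smaller: "\<forall>b\<in>?N. card (degrees b) < card (degrees a) \<longrightarrow> b \<in> homogeneous_core ?N"
      using less.hyps by blast
    have "component a i \<in> ?N" for i
    proof -
      let ?J = "(\<lambda>z. z i) ` simultaneous_multiples (component a)"
      have "nilpotent (z i)" if z: "z \<in> simultaneous_multiples (component a)" for z
      proof -
        define Z where "Z = sum z (degrees a)"
        have "Z \<in> ?N"
          unfolding Z_def
          by (rule sum_simultaneous_multiples_mem[OF N _ z]) (simp add: a sum_component)
        then obtain n where "((*) Z ^^ n) Z = 0"
          using nil unfolding nilpotent_def by blast
        then have "z i * ((*) Z ^^ n) Z \<in> homogeneous_core ?N"
          by (simp add: homogeneous_core_def component_zero two_sided_ideal_closed(1)[OF N])
        then have "z i * ((*) (z i) ^^ n) (z i) \<in> homogeneous_core ?N"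
          by (rule simultaneous_multiples_cancel_power[OF N a smaller z Z_def])
        then have "((*) (z i) ^^ Suc n) (z i) \<in> ?N"
          using homogeneous_core_subset[OF N] by auto
        from nil[OF this] show ?thesis by (rule nilpotent_of_power)
      qed
      then have "nil_ideal ?J"
        unfolding nil_ideal_def by (intro conjI ballI two_sided_ideal_entries) auto
      then show ?thesis
        using nil_ideal_subset_nil_radical simultaneous_multiples.base by blast
    qed
    then show ?case by (simp add: homogeneous_core_def)
  qed
qed

end

theorem theorem0p1:
  fixes R :: "int \<Rightarrow> 'a::ring set"
  assumes "int_graded R"
  shows "homogeneous_ideal R nil_radical"
proof -
  interpret int_graded_ring R by standard (rule assms)
  show ?thesis
    using nil_ideal_nil_radical nil_radical_subset_homogeneous_core
    by (intro homogeneous_idealI) (auto simp only: nil_ideal_def)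
qed

end
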